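(* Let $\mathcal{B}=\langle\{0,1,2,3\};\beta\rangle$ be the groupoid whose operation $\beta$ is commutative, with $0\,\beta\,x=x$ and $x\,\beta\,x=x$ for all $x\in\{0,1,2,3\}$, and $1\,\beta\,2=3$, $1\,\beta\,3=2$, $2\,\beta\,3=1$. Then $\mathcal{B}$ is completely dissociative.
   Context: A groupoid $\langle G;\diamond\rangle$ is a set $G$ with a binary operation $\diamond$ on $G$. $\mathbf{N}=\{1,2,3,\ldots\}$, and $G^\omega$ is the set of infinite sequences $\vec g=g_0g_1g_2\ldots$ of elements of $G$. For $k\in\mathbf{N}$, $F^\sigma(k)$ is the set of formal $k$-products: the finite words $\mathbf{u}$ over the alphabet $\{\bullet,x_0,x_1,x_2,\ldots\}$ such that (1) $x_0x_1\ldots x_{k-1}$ is a subsequence of $\mathbf{u}$; (2) $\mathbf{u}$ has length $2k-1$; (3) $\bullet$ occurs exactly $k-1$ times in $\mathbf{u}$; (4) in every nonempty prefix of $\mathbf{u}$ the number of occurrences of $\bullet$ is strictly less than the number of other letters. These are exactly the reverse Polish forms of the full parenthesizations of $x_0x_1\ldots x_{k-1}$ (each variable once, in this order). For $\mathbf{u}\in F^\sigma(k)$ and $\vec g\in G^\omega$, $\vec g\,\mathbf{u}^\diamond\in G$ is the element obtained by replacing each $x_i$ in $\mathbf{u}$ by $g_i$ and each $\bullet$ by $\diamond$ and evaluating in reverse Polish notation ($ab\diamond$ means $a\diamond b$). $\langle G;\diamond\rangle$ is $k$-dissociative iff for every pair $\mathbf{u}\neq\mathbf{v}$ in $F^\sigma(k)$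 there is $\vec g\in G^\omega$ with $\vec g\,\mathbf{u}^\diamond\neq\vec g\,\mathbf{v}^\diamond$. It is completely dissociative iff it is $k$-dissociative for every $k\ge 3$. *)

theory Defs
  imports Main "HOL-Library.Sublist"
begin

definition groupoid :: "'a set \<Rightarrow> ('a \<Rightarrow> 'a \<Rightarrow> 'a) \<Rightarrow> bool" where
  "groupoid G f \<longleftrightarrow> (\<forall>a\<in>G. \<forall>b\<in>G. f a b \<in> G)"

datatype letter = Bullet | Var nat

text \<open>The formal \<open>k\<close>-products, for \<open>k \<ge> 1\<close>. Length \<open>2k - 1\<close> and \<open>k - 1\<close> bullets are written
  additively to avoid truncated subtraction, so that the set is empty for \<open>k = 0\<close>.\<close>

definition formal_products :: "nat \<Rightarrow> letter list set" where
  "formal_products k = {u.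
     subseq (map Var [0..<k]) u \<and>
     length u + 1 = 2 * k \<and>
     count_list u Bullet + 1 = k \<and>
     (\<forall>p. prefix p u \<and> p \<noteq> [] \<longrightarrow>
        count_list p Bullet < length (filter (\<lambda>l. l \<noteq> Bullet) p))}"

text \<open>Reverse Polish evaluation on a stack whose top is the head of the list, so the second
  operand is on top. The last equation (stack underflow) is never reached from the empty stack
  on a formal product, by the prefix condition.\<close>

fun rpn_step :: "('a \<Rightarrow> 'a \<Rightarrow> 'a) \<Rightarrow> (nat \<Rightarrow> 'a) \<Rightarrow> letter \<Rightarrow> 'a list \<Rightarrow> 'a list" where
  "rpn_step f g (Var i) st = g i # st"
| "rpn_step f g Bullet (b # a # st) = f a b # st"
| "rpn_step f g Bullet st = []"

definition rpn_eval :: "('a \<Rightarrow> 'a \<Rightarrow> 'a) \<Rightarrow> (nat \<Rightarrow> 'a) \<Rightarrow> letter list \<Rightarrow> 'a" where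
  "rpn_eval f g u = hd (fold (rpn_step f g) u [])"

definition k_dissociative :: "nat \<Rightarrow> 'a set \<Rightarrow> ('a \<Rightarrow> 'a \<Rightarrow> 'a) \<Rightarrow> bool" where
  "k_dissociative k G f \<longleftrightarrow>
     (\<forall>u\<in>formal_products k. \<forall>v\<in>formal_products k. u \<noteq> v \<longrightarrow>
        (\<exists>g. (\<forall>i. g i \<in> G) \<and> rpn_eval f g u \<noteq> rpn_eval f g v))"

definition completely_dissociative :: "'a set \<Rightarrow> ('a \<Rightarrow> 'a \<Rightarrow> 'a) \<Rightarrow> bool" where
  "completely_dissociative G f \<longleftrightarrow> (\<forall>k\<ge>3. k_dissociative k G f)"

end

theory Submission
  imports Defs
begin

text \<open>
  The reason is that \<open>\<B>\<close> has a two-sided identity, \<open>0\<close>, and is not associative: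
  \<open>(1 \<beta> 2) \<beta> 3 = 3\<close> while \<open>1 \<beta> (2 \<beta> 3) = 1\<close>. Every groupoid with these two properties is
  completely dissociative (\<open>unital_nonassociative_completely_dissociative\<close>).

  A formal \<open>k\<close>-product is the reverse Polish form of a binary tree whose leaves, from left to
  right, are \<open>x\<^sub>0, \<dots>, x\<^bsub>k-1\<^esub>\<close>. Substituting the identity for a variable deletes its leaf from the
  tree, so substituting the identity for all but three variables leaves one of the two trees on three
  leaves, \<open>(ab)c\<close> or \<open>a(bc)\<close>. Two different trees with the same leaves disagree on the shape that
  remains for a suitable choice of three variables: descend to the first place where the two
  trees split the same block of variables differently, say as \<open>A | B\<close> and as \<open>C | D\<close> with \<open>A\<close> a proper
  prefix of \<open>C\<close>, and keep one variable from \<open>A\<close>, one from \<open>C\<close> beyond \<open>A\<close>, and one from \<open>D\<close>. Giving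
  these three variables the values of a nonassociating triple separates the two products.
\<close>

section \<open>Formal products as binary trees\<close>

datatype bracketing = Leaf nat | Node bracketing bracketing

fun leaves :: "bracketing \<Rightarrow> nat list" where
  "leaves (Leaf i) = [i]"
| "leaves (Node s t) = leaves s @ leaves t"

fun rpn :: "bracketing \<Rightarrow> letter list" where
  "rpn (Leaf i) = [Var i]"
| "rpn (Node s t) = rpn s @ rpn t @ [Bullet]"

fun eval_tree :: "('a \<Rightarrow> 'a \<Rightarrow> 'a) \<Rightarrow> (nat \<Rightarrow> 'a) \<Rightarrow> bracketing \<Rightarrow> 'a" where
  "eval_tree f g (Leaf i) = g i"
| "eval_tree f g (Node s t) = f (eval_tree f g s) (eval_tree f g t)"

lemma leaves_nonempty [simp]: "leaves t \<noteq> []"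
  by (induction t) auto

lemma variables_of_rpn: "filter (\<lambda>l. l \<noteq> Bullet) (rpn t) = map Var (leaves t)"
  by (induction t) auto

lemma fold_rpn_step_rpn: "fold (rpn_step f g) (rpn t) st = eval_tree f g t # st"
  by (induction t arbitrary: st) auto

lemma rpn_eval_rpn: "rpn_eval f g (rpn t) = eval_tree f g t"
  by (simp add: rpn_eval_def fold_rpn_step_rpn)

text \<open>
  Parsing is reverse Polish evaluation in the free groupoid, that is, with \<open>Node\<close> as the operation
  and each variable standing for itself. The stack then records everything that has been read, and
  its height is the surplus of variables over bullets, so the prefix condition excludes underflow.
\<close>

lemma symbolic_evaluation_parses:
  assumes "\<And>p. prefix p u \<Longrightarrow> p \<noteq> [] \<Longrightarrow>
             count_list p Bullet < length (filter (\<lambda>l. l \<noteq> Bullet) p)"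
  shows "concat (map rpn (rev (fold (rpn_step Node Leaf) u []))) = u \<and>
         length (fold (rpn_step Node Leaf) u []) + count_list u Bullet
           = length (filter (\<lambda>l. l \<noteq> Bullet) u)"
  using assms
proof (induction u rule: rev_induct)
  case Nil
  then show ?case by simp
next
  case (snoc l u)
  define st where "st = fold (rpn_step Node Leaf) u []"
  have IH: "concat (map rpn (rev st)) = u"
    "length st + count_list u Bullet = length (filter (\<lambda>l. l \<noteq> Bullet) u)"
    using snoc.IH snoc.prems by (auto simp: st_def)
  show ?case
  proof (cases l)
    case (Var i)
    then show ?thesis using IH by (simp flip: st_def)
  next
    case Bullet
    have "count_list u Bullet + 1 < length (filter (\<lambda>l. l \<noteq> Bullet) u)"
      using snoc.prems[of "u @ [l]"] Bullet by simp
    then have "2 \<le> length st"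
      using IH(2) by linarith
    then obtain b a st' where "st = b # a # st'"
      by (metis Suc_le_length_iff numeral_2_eq_2)
    then show ?thesis using IH Bullet by (auto simp flip: st_def)
  qed
qed

lemma formal_product_is_rpn:
  assumes "u \<in> formal_products k"
  obtains t where "u = rpn t" "leaves t = [0..<k]"
proof -
  define vs where "vs = filter (\<lambda>l. l \<noteq> Bullet) u"
  define st where "st = fold (rpn_step Node Leaf) u []"
  have sub: "subseq (map Var [0..<k]) u" and len: "length u + 1 = 2 * k"
    and bullets: "count_list u Bullet + 1 = k"
    and pre: "\<And>p. prefix p u \<Longrightarrow> p \<noteq> [] \<Longrightarrow>
                count_list p Bullet < length (filter (\<lambda>l. l \<noteq> Bullet) p)"
    using assms by (auto simp: formal_products_def)
  have "length vs + count_list u Bullet = length u"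
    unfolding vs_def by (induction u) auto
  then have length_vs: "length vs = k"
    using len bullets by linarith
  have "subseq (filter (\<lambda>l. l \<noteq> Bullet) (map Var [0..<k])) vs"
    unfolding vs_def by (rule subseq_filter[OF sub])
  then have "subseq (map Var [0..<k]) vs"
    by (simp add: filter_map o_def)
  then have vs: "vs = map Var [0..<k]"
    using length_vs subseq_same_length by fastforce
  have parse: "concat (map rpn (rev st)) = u" "length st + count_list u Bullet = length vs"
    using symbolic_evaluation_parses[OF pre] by (simp_all add: st_def vs_def)
  have "length st = 1"
    using parse(2) length_vs bullets by linarith
  then obtain t where "st = [t]"
    by (auto simp: length_Suc_conv)
  then have u: "u = rpn t"
    using parse(1) by simp
  then have "map Var (leaves t) = map Var [0..<k]"
    using vs variables_of_rpn[of t] by (simp add: vs_def)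
  then have "leaves t = [0..<k]"
    by (simp add: inj_map_eq_map inj_def)
  with u show thesis by (rule that)
qed

section \<open>Deleting leaves by substituting the identity\<close>

locale unital_groupoid =
  fixes G :: "'a set" and f :: "'a \<Rightarrow> 'a \<Rightarrow> 'a" and e :: 'a
  assumes closed: "a \<in> G \<Longrightarrow> b \<in> G \<Longrightarrow> f a b \<in> G"
    and unit_mem: "e \<in> G"
    and left_unit: "a \<in> G \<Longrightarrow> f e a = a"
    and right_unit: "a \<in> G \<Longrightarrow> f a e = a"
begin

definition surviving :: "(nat \<Rightarrow> 'a) \<Rightarrow> bracketing \<Rightarrow> 'a list" where
  "surviving g t = filter (\<lambda>a. a \<noteq> e) (map g (leaves t))"

lemma surviving_simps [simp]:
  "surviving g (Leaf i) = (if g i = e then [] else [g i])"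
  "surviving g (Node s t) = surviving g s @ surviving g t"
  by (auto simp: surviving_def)

lemma eval_tree_mem: "range g \<subseteq> G \<Longrightarrow> eval_tree f g t \<in> G"
  by (induction t) (auto intro: closed)

text \<open>
  A subtree without survivors has value \<open>e\<close>, which its parent absorbs. Hence the value of a tree
  depends only on its survivors, in order, and on the shape that they span; for at most two of them
  there is only one shape.
\<close>

lemma eval_tree_no_survivor: "surviving g t = [] \<Longrightarrow> eval_tree f g t = e"
  by (induction t) (auto simp: left_unit unit_mem split: if_splits)

lemma eval_tree_one_survivor:
  "range g \<subseteq> G \<Longrightarrow> surviving g t = [a] \<Longrightarrow> eval_tree f g t = a"
proof (induction t)
  case (Node s t)
  have "eval_tree f g s \<in> G" "eval_tree f g t \<in> G"
    using Node.prems(1) by (simp_all add: eval_tree_mem)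
  then show ?case
    using Node
    by (auto simp: append_eq_Cons_conv eval_tree_no_survivor left_unit right_unit)
qed (auto split: if_splits)

lemma eval_tree_two_survivors:
  "range g \<subseteq> G \<Longrightarrow> surviving g t = [a, b] \<Longrightarrow> eval_tree f g t = f a b"
proof (induction t)
  case (Node s t)
  have "eval_tree f g s \<in> G" "eval_tree f g t \<in> G"
    using Node.prems(1) by (simp_all add: eval_tree_mem)
  then show ?case
    using Node
    by (auto simp: append_eq_Cons_conv eval_tree_no_survivor eval_tree_one_survivor
        left_unit right_unit)
qed (auto split: if_splits)

section \<open>Separating different trees\<close>

text \<open>
  The disagreement at the root: \<open>s\<close> ends strictly before \<open>s'\<close> does, so that the first leaf of \<open>s\<close>,
  the first leaf of \<open>s'\<close> beyond \<open>s\<close> and the first leaf of \<open>t'\<close> are grouped as \<open>a(bc)\<close> by one tree and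
  as \<open>(ab)c\<close> by the other.
\<close>

lemma separate_different_splits:
  assumes triple: "a \<in> G" "b \<in> G" "c \<in> G" "f (f a b) c \<noteq> f a (f b c)"
    and dist: "distinct (leaves s @ leaves t)"
    and xs: "leaves s' = leaves s @ xs" "leaves t = xs @ leaves t'" "xs \<noteq> []"
  shows "\<exists>g. range g \<subseteq> G \<and> eval_tree f g (Node s t) \<noteq> eval_tree f g (Node s' t')"
proof -
  have ne: "a \<noteq> e" "b \<noteq> e" "c \<noteq> e"
    using triple by (auto simp: left_unit right_unit closed)
  obtain i ks where i: "leaves s = i # ks"
    by (cases "leaves s") auto
  obtain j js where j: "xs = j # js"
    using xs(3) by (cases xs) auto
  obtain l ls where l: "leaves t' = l # ls"
    by (cases "leaves t'") auto
  define g where "g = (\<lambda>_. e)(i := a, j := b, l := c)"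
  have mem: "range g \<subseteq> G"
    using triple unit_mem by (auto simp: g_def)
  have gvals: "g i = a" "g j = b" "g l = c"
    using dist by (auto simp: g_def xs(2) i j l)
  have others: "filter (\<lambda>a. a \<noteq> e) (map g ms) = []" if "set ms \<inter> {i, j, l} = {}" for ms
    using that by (auto simp: filter_empty_conv g_def)
  have "filter (\<lambda>a. a \<noteq> e) (map g ks) = []" "filter (\<lambda>a. a \<noteq> e) (map g js) = []"
       "filter (\<lambda>a. a \<noteq> e) (map g ls) = []"
    using dist by (auto simp only: xs(2) i j l intro!: others) auto
  then have "surviving g s = [a]" "surviving g t = [b, c]"
            "surviving g s' = [a, b]" "surviving g t' = [c]"
    using ne by (simp_all add: surviving_def xs(1,2) i j l gvals)
  then have "eval_tree f g (Node s t) = f a (f b c)" "eval_tree f g (Node s' t') = f (f a b) c"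
    using mem by (simp_all add: eval_tree_one_survivor eval_tree_two_survivors)
  with mem triple(4) show ?thesis by metis
qed

text \<open>
  If both trees split their leaves at the same place, they differ in the left or in the right
  subtrees. An assignment that separates these is extended by \<open>e\<close> on the other side, whose value
  then disappears at the root.
\<close>

lemma separate_trees:
  assumes triple: "a \<in> G" "b \<in> G" "c \<in> G" "f (f a b) c \<noteq> f a (f b c)"
  shows "t \<noteq> t' \<Longrightarrow> leaves t = leaves t' \<Longrightarrow> distinct (leaves t) \<Longrightarrow>
    \<exists>g. range g \<subseteq> G \<and> eval_tree f g t \<noteq> eval_tree f g t'"
proof (induction t arbitrary: t')
  case (Leaf i)
  then show ?case
    by (cases t') (auto simp: Cons_eq_append_conv)
next
  case (Node s t)
  show ?case
  proof (cases t')
    case (Leaf i)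
    then show ?thesis
      using Node.prems by (auto simp: append_eq_Cons_conv)
  next
    case t': (Node s' t'')
    \<comment> \<open>Erase all variables outside the subtree in which a separating assignment is known.\<close>
    define restrict where
      "restrict g r = (\<lambda>i. if i \<in> set (leaves r) then g i else e)" for g :: "nat \<Rightarrow> 'a" and r
    have restrict_mem: "range (restrict g r) \<subseteq> G" if "range g \<subseteq> G" for g r
      using that unit_mem by (auto simp: restrict_def)
    have eval_cong: "eval_tree f g r = eval_tree f h r"
      if "\<And>i. i \<in> set (leaves r) \<Longrightarrow> g i = h i" for g h r
      using that by (induction r) auto
    have inside: "eval_tree f (restrict g r) q = eval_tree f g q"
      if "leaves q = leaves r" for g q r
      using that by (intro eval_cong) (auto simp: restrict_def)
    have outside: "eval_tree f (restrict g r) q = e"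
      if "set (leaves q) \<inter> set (leaves r) = {}" for g q r
      using that
      by (intro eval_tree_no_survivor) (auto simp: surviving_def restrict_def filter_empty_conv)
    have eq: "leaves s @ leaves t = leaves s' @ leaves t''"
      using Node.prems t' by simp
    have dist: "distinct (leaves s @ leaves t)" "distinct (leaves s' @ leaves t'')"
      using Node.prems t' by auto
    obtain xs where
      "leaves s = leaves s' @ xs \<and> xs @ leaves t = leaves t'' \<or>
       leaves s @ xs = leaves s' \<and> leaves t = xs @ leaves t''"
      using eq by (auto simp: append_eq_append_conv2)
    then consider (same) "leaves s = leaves s'" "leaves t = leaves t''"
      | (longer) "xs \<noteq> []" "leaves s = leaves s' @ xs" "leaves t'' = xs @ leaves t"
      | (shorter) "xs \<noteq> []" "leaves s' = leaves s @ xs" "leaves t = xs @ leaves t''"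
      by (cases "xs = []") auto
    then show ?thesis
    proof cases
      case same
      consider "s \<noteq> s'" | "t \<noteq> t''"
        using Node.prems(1) t' by auto
      then show ?thesis
      proof cases
        case 1
        then obtain g where g: "range g \<subseteq> G" "eval_tree f g s \<noteq> eval_tree f g s'"
          using Node.IH(1)[of s'] same dist by auto
        have "eval_tree f (restrict g s) (Node s t) = eval_tree f g s"
             "eval_tree f (restrict g s) (Node s' t'') = eval_tree f g s'"
          using dist same g(1)
          by (simp_all add: inside outside right_unit eval_tree_mem Int_commute)
        then show ?thesis
          using g restrict_mem t' by metis
      next
        case 2
        then obtain g where g: "range g \<subseteq> G" "eval_tree f g t \<noteq> eval_tree f g t''"
          using Node.IH(2)[of t''] same dist by auto
        have "eval_tree f (restrict g t) (Node s t) = eval_tree f g t"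
             "eval_tree f (restrict g t) (Node s' t'') = eval_tree f g t''"
          using dist same g(1)
          by (simp_all add: inside outside left_unit eval_tree_mem)
        then show ?thesis
          using g restrict_mem t' by metis
      qed
    next
      case longer
      then show ?thesis
        using separate_different_splits[OF triple dist(2)] t' by metis
    next
      case shorter
      then show ?thesis
        using separate_different_splits[OF triple dist(1)] t' by metis
    qed
  qed
qed

theorem unital_nonassociative_completely_dissociative:
  assumes "a \<in> G" "b \<in> G" "c \<in> G" "f (f a b) c \<noteq> f a (f b c)"
  shows "completely_dissociative G f"
  unfolding completely_dissociative_def k_dissociative_def
proof (intro allI impI ballI)
  fix k :: nat and u v
  assume u: "u \<in> formal_products k" and v: "v \<in> formal_products k" and "u \<noteq> v"
  obtain s where s: "u = rpn s" "leaves s = [0..<k]"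
    using u by (rule formal_product_is_rpn)
  obtain t where t: "v = rpn t" "leaves t = [0..<k]"
    using v by (rule formal_product_is_rpn)
  have "s \<noteq> t"
    using \<open>u \<noteq> v\<close> s t by auto
  then obtain g where "range g \<subseteq> G" "eval_tree f g s \<noteq> eval_tree f g t"
    using separate_trees[OF assms, of s t] s t by auto
  then show "\<exists>g. (\<forall>i. g i \<in> G) \<and> rpn_eval f g u \<noteq> rpn_eval f g v"
    using s t by (auto simp: rpn_eval_rpn)
qed

end

theorem theorem3p3:
  fixes B :: "nat set" and \<beta> :: "nat \<Rightarrow> nat \<Rightarrow> nat"
  assumes "B = {0, 1, 2, 3}"
    and "\<And>x y. x \<in> B \<Longrightarrow> y \<in> B \<Longrightarrow> \<beta> x y = \<beta> y x"
    and "\<And>x. x \<in> B \<Longrightarrow> \<beta> 0 x = x"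
    and "\<And>x. x \<in> B \<Longrightarrow> \<beta> x x = x"
    and "\<beta> 1 2 = 3" and "\<beta> 1 3 = 2" and "\<beta> 2 3 = 1"
  shows "groupoid B \<beta> \<and> completely_dissociative B \<beta>"
proof -
  have mem: "0 \<in> B" "1 \<in> B" "2 \<in> B" "3 \<in> B"
    using assms(1) by auto
  have right_unit: "\<beta> x 0 = x" if "x \<in> B" for x
    using assms(2)[OF that mem(1)] assms(3)[OF that] by simp
  have "\<beta> 2 1 = 3" "\<beta> 3 1 = 2" "\<beta> 3 2 = 1"
    using assms(2) assms(5-7) mem by metis+
  then have table: "\<forall>x\<in>{0, 1, 2, 3}. \<forall>y\<in>{0, 1, 2, 3}. \<beta> x y \<in> B"
    using mem assms(3-7) right_unit by simp
  have closed: "\<beta> x y \<in> B" if "x \<in> B" "y \<in> B" for x y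
    by (rule table[folded assms(1), rule_format, OF that])
  interpret unital_groupoid B \<beta> 0
    using closed mem assms(3) right_unit by unfold_locales auto
  have "\<beta> (\<beta> 1 2) 3 \<noteq> \<beta> 1 (\<beta> 2 3)"
    using assms(4)[OF mem(2)] assms(4)[OF mem(4)] assms(5,7) by simp
  then have "completely_dissociative B \<beta>"
    by (rule unital_nonassociative_completely_dissociative[OF mem(2-4)])
  with closed show ?thesis
    by (simp add: groupoid_def)
qed

end
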